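(* Let $\underline{u}=(u_i)_{i\ge 0}\in \mathbb{N}_0^{\mathbb{N}_0}$ satisfy $u_0=0$, $\underline{u}\preceq \sigma^n \underline{u}$ for all $n\geq 0$, and $\max_{i\in \mathbb{N}_0}u_i=:K<\infty$. For $\beta>K+2$ put $$\alpha(\beta)=(\beta-1)\sum_{j=0}^\infty \frac{u_j}{\beta^{j+1}}.$$ Then $$\dim_H\{\beta>K+2:\ \Sigma_{\alpha(\beta),\beta}\ \text{has the specification property}\}=1,$$ where $\dim_H E$ denotes the Hausdorff dimension of $E\subset\mathbb{R}$.
   Context: $\mathbb{N}_0$ is the set of non-negative integers, $\mathbb{N}$ the set of positive integers. $\preceq$ is the lexicographic order on sequences in $\mathbb{N}_0^{\mathbb{N}_0}$, and $\sigma$ is the shift map, $(\sigma(\underline{x}))_i=x_{i+1}$. $(\alpha,\beta)$-transformation: for $0\le\alpha<1$ and $\beta>1$, $T_{\alpha,\beta}:[0,1)\to[0,1)$ is $T_{\alpha,\beta}(x)=\beta x+\alpha-\lfloor \beta x+\alpha\rfloor$. Coding: let $k=\lceil \alpha+\beta\rceil$, $A=\{0,1,\dots,k-1\}$, $I_0=[0,\frac{1-\alpha}{\beta})$, $I_j=[\frac{j-\alpha}{\beta},\frac{j+1-\alpha}{\beta})$ for $1\le j\le k-2$, and $I_{k-1}=[\frac{k-1-\alpha}{\beta},1)$. The coding map $i_{\alpha,\beta}:[0,1)\to A^{\mathbb{N}_0}$ is defined by $i_{\alpha,\beta}(x)_n=j$ iff $T_{\alpha,\beta}^n(x)\in I_j$.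 $(\alpha,\beta)$-shift: $\Sigma_{\alpha,\beta}$ is the closure of $\{i_{\alpha,\beta}(x): x\in[0,1)\}$ in $A^{\mathbb{N}_0}$, where $A^{\mathbb{N}_0}$ carries the metric $d(x,y)=2^{-\min\{k: x_k\ne y_k\}}$ (product topology). It is a subshift, i.e. a compact set $X\subset A^{\mathbb{N}_0}$ with $\sigma(X)\subset X$. Language: for a subshift $X$ and a finite word $w$ over $A$ of length $|w|\ge1$, the cylinder $[w]$ is the set of $x\in X$ whose first $|w|$ symbols form $w$; $\mathcal{L}(X)$ is the set of finite words $w$ of length $\ge 1$ with $[w]\neq\emptyset$. Specification property: a subshift $X$ has specification with gap size $t\in\mathbb{N}$ if for all $m\in\mathbb{N}$ and $w^1,\dots,w^m\in\mathcal{L}(X)$ there exist $v^1,\dots,v^{m-1}\in\mathcal{L}(X)$ with $|v^i|=t$ for all $i$ such that $x:=w^1v^1w^2v^2\cdots v^{m-1}w^m\in\mathcal{L}(X)$, and moreover the cylinder $[x]$ contains a periodic point of period exactly $|x|+t$, i.e. a point $y\in[x]$ with $\sigma^{|x|+t}(y)=y$. $X$ has the specification property if it has specification with gap size $t$ for some $t\in\mathbb{N}$. *)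

theory Defs
  imports "HOL-Analysis.Analysis" "HOL-Library.Fun_Lexorder"
begin

section \<open>Sequences\<close>

definition lex_le :: "(nat \<Rightarrow> nat) \<Rightarrow> (nat \<Rightarrow> nat) \<Rightarrow> bool" where
  "lex_le x y \<longleftrightarrow> x = y \<or> less_fun x y"

definition shift_map :: "(nat \<Rightarrow> 'a) \<Rightarrow> nat \<Rightarrow> 'a" where
  "shift_map x = (\<lambda>i. x (Suc i))"

section \<open>Intermediate beta-transformations and their shifts\<close>

definition T_ab :: "real \<Rightarrow> real \<Rightarrow> real \<Rightarrow> real" where
  "T_ab \<alpha> \<beta> x = \<beta> * x + \<alpha> - of_int \<lfloor>\<beta> * x + \<alpha>\<rfloor>"

definition num_symbols :: "real \<Rightarrow> real \<Rightarrow> nat" where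
  "num_symbols \<alpha> \<beta> = nat \<lceil>\<alpha> + \<beta>\<rceil>"

text \<open>The intervals with index \<open>j < num_symbols \<alpha> \<beta>\<close> partition \<open>[0,1)\<close> when \<open>0 \<le> \<alpha> < 1 < \<beta>\<close>
  (then \<open>num_symbols \<alpha> \<beta> \<ge> 2\<close>, so the first two cases do not overlap); other indices are
  never used.\<close>

definition branch_interval :: "real \<Rightarrow> real \<Rightarrow> nat \<Rightarrow> real set" where
  "branch_interval \<alpha> \<beta> j =
     (if j = 0 then {0 ..< (1 - \<alpha>) / \<beta>}
      else if j = num_symbols \<alpha> \<beta> - 1 then {(real j - \<alpha>) / \<beta> ..< 1}
      else {(real j - \<alpha>) / \<beta> ..< (real j + 1 - \<alpha>) / \<beta>})"

definition coding :: "real \<Rightarrow> real \<Rightarrow> real \<Rightarrow> nat \<Rightarrow> nat" where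
  "coding \<alpha> \<beta> x n =
     (THE j. j < num_symbols \<alpha> \<beta> \<and> (T_ab \<alpha> \<beta> ^^ n) x \<in> branch_interval \<alpha> \<beta> j)"

text \<open>The closure refers to the product topology on \<open>nat \<Rightarrow> nat\<close>, with \<open>nat\<close> discrete. The set of
  sequences with all entries below \<open>num_symbols \<alpha> \<beta>\<close> is closed and carries the subspace topology,
  so this is also the closure within that set.\<close>

definition ab_shift :: "real \<Rightarrow> real \<Rightarrow> (nat \<Rightarrow> nat) set" where
  "ab_shift \<alpha> \<beta> = closure (coding \<alpha> \<beta> ` {0..<1})"

section \<open>Language and specification\<close>

definition cylinder :: "(nat \<Rightarrow> 'a) set \<Rightarrow> 'a list \<Rightarrow> (nat \<Rightarrow> 'a) set" where
  "cylinder X w = {x \<in> X. \<forall>i < length w. x i = w ! i}"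

definition language :: "(nat \<Rightarrow> 'a) set \<Rightarrow> 'a list set" where
  "language X = {w. w \<noteq> [] \<and> cylinder X w \<noteq> {}}"

text \<open>Note that \<open>splice [w\<^sub>1, \<dots>, w\<^sub>m] [v\<^sub>1, \<dots>, v\<^sub>m\<^sub>-\<^sub>1] = [w\<^sub>1, v\<^sub>1, w\<^sub>2, \<dots>, v\<^sub>m\<^sub>-\<^sub>1, w\<^sub>m]\<close>.\<close>

definition specification_gap :: "(nat \<Rightarrow> 'a) set \<Rightarrow> nat \<Rightarrow> bool" where
  "specification_gap X t \<longleftrightarrow>
     (\<forall>ws. ws \<noteq> [] \<and> set ws \<subseteq> language X \<longrightarrow>
        (\<exists>vs. length vs = length ws - 1 \<and> set vs \<subseteq> language X \<and> (\<forall>v \<in> set vs. length v = t) \<and>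
           (let x = concat (splice ws vs) in
              x \<in> language X \<and>
              (\<exists>y \<in> cylinder X x. (shift_map ^^ (length x + t)) y = y))))"

definition specification_property :: "(nat \<Rightarrow> 'a) set \<Rightarrow> bool" where
  "specification_property X \<longleftrightarrow> (\<exists>t > 0. specification_gap X t)"

section \<open>Hausdorff dimension\<close>

text \<open>Covering sets are required to be bounded, since \<open>diameter\<close> is meaningless otherwise.
  The case distinction accounts for \<open>0 powr 0 = 0\<close>: the conventions are that the empty set
  contributes \<open>0\<close>, and that a nonempty set contributes \<open>1\<close> if \<open>s = 0\<close>.\<close>

definition diam_power :: "real \<Rightarrow> 'a::metric_space set \<Rightarrow> ennreal" where
  "diam_power s U = (if U = {} then 0 else if s = 0 then 1 else ennreal (diameter U powr s))"

definition hausdorff_premeasure :: "real \<Rightarrow> real \<Rightarrow> 'a::metric_space set \<Rightarrow> ennreal" where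
  "hausdorff_premeasure s \<delta> E =
     (INF U \<in> {U :: nat \<Rightarrow> 'a set. E \<subseteq> (\<Union>i. U i) \<and> (\<forall>i. bounded (U i) \<and> diameter (U i) \<le> \<delta>)}.
        \<Sum>i. diam_power s (U i))"

definition hausdorff_measure :: "real \<Rightarrow> 'a::metric_space set \<Rightarrow> ennreal" where
  "hausdorff_measure s E = (SUP \<delta> \<in> {0<..}. hausdorff_premeasure s \<delta> E)"

definition hausdorff_dim :: "'a::metric_space set \<Rightarrow> ennreal" where
  "hausdorff_dim E = (INF s \<in> {s. 0 \<le> s \<and> hausdorff_measure s E = 0}. ennreal s)"

section \<open>The parameter curve\<close>

definition alpha_of :: "(nat \<Rightarrow> nat) \<Rightarrow> real \<Rightarrow> real" where
  "alpha_of u \<beta> = (\<beta> - 1) * (\<Sum>j. real (u j) / \<beta> ^ (j + 1))"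

end

theory Submission
  imports Defs "HOL-Library.Omega_Words_Fun" "HOL-Real_Asymp.Real_Asymp"
begin

text \<open>
  Only the lower bound needs the dynamics. Fix a large \<open>N\<close> and consider the \<open>\<beta> \<in> (N, N + 1)\<close> for which the upper kneading sequence \<open>v\<close> (the expansion of
  \<open>1\<close>) is \<open>v\<^sub>0 = N\<close> and \<open>v\<^sub>j = u\<^sub>j + d\<^sub>j\<close> with \<open>K + 2 \<le> d\<^sub>j \<le> N - K - 1\<close> for \<open>j \<ge> 1\<close>. Then the symbol \<open>K + 1\<close> is larger than all
  \<open>u\<^sub>j\<close> and smaller than all \<open>v\<^sub>j\<close>, so it may follow every word of the language and may itself
  be followed by every sequence of the shift; hence specification holds with gap size \<open>1\<close>. Such a \<open>\<beta>\<close> is the root of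
  \<open>\<Sum>j. d\<^sub>j / \<beta>^(j+1) = 1\<close> with \<open>d\<^sub>0 = N\<close>, the digits \<open>d\<^sub>j\<close> range freely over \<open>M = N - 2K - 2\<close> values,
  and roots whose digits first differ at position \<open>n\<close> are at distance at least a constant times \<open>(N + 1)^(-n)\<close>.
  Reading the digits off the base \<open>M\<close> expansion of \<open>t \<in> [0,1)\<close> therefore parametrises a set of
  dimension at least \<open>log M / log (N + 1)\<close>, which tends to \<open>1\<close> as \<open>N \<rightarrow> \<infinity>\<close>.
\<close>

section \<open>Bounds on Hausdorff measure\<close>

lemma dist_powr_le_diam_power:
  assumes "bounded U" "x \<in> U" "y \<in> U" "0 \<le> s"
  shows "ennreal (dist x y powr s) \<le> diam_power s U"
proof -
  have d: "dist x y \<le> diameter U"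
    using assms by (intro diameter_bounded_bound)
  show ?thesis
  proof (cases "s = 0")
    case True
    then show ?thesis using assms by (auto simp: diam_power_def)
  next
    case False
    then show ?thesis
      using assms d by (auto simp: diam_power_def intro!: ennreal_leI powr_mono2)
  qed
qed

text \<open>Covers are pulled back along \<open>g\<close>: a covering set catches only parameters
  within \<open>C\<close> times its diameter power of each other, so the length of [0,1) bounds
  every covering sum from below.\<close>

lemma hausdorff_measure_nonzero_if_inverse_hoelder:
  fixes g :: "real \<Rightarrow> 'a::metric_space"
  assumes gE: "g ` {0..<1} \<subseteq> E" and C: "0 < C" and s: "0 \<le> s"
    and hoelder: "\<And>t t'. t \<in> {0..<1} \<Longrightarrow> t' \<in> {0..<1} \<Longrightarrow> \<bar>t - t'\<bar> \<le> C * dist (g t) (g t') powr s"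
  shows "hausdorff_measure s E \<noteq> 0"
proof -
  have *: "ennreal (1 / (2 * C)) \<le> (\<Sum>i. diam_power s (U i))"
    if cover: "E \<subseteq> (\<Union>i. U i)" and bdd: "\<And>i. bounded (U i)" for U :: "nat \<Rightarrow> 'a set"
  proof -
    define P where "P i = {t \<in> {0..<1}. g t \<in> U i}" for i
    \<comment> \<open>Enlarging \<open>P i\<close> to an interval centred at one of its points makes
      it measurable.\<close>
    have "\<exists>J. J \<in> sets lborel \<and> P i \<subseteq> J \<and> emeasure lborel J \<le> ennreal (2 * C) * diam_power s (U i)" for i
    proof (cases "P i = {}")
      case True
      then show ?thesis by (intro exI[of _ "{}"]) auto
    next
      case False
      then obtain t0 where t0: "t0 \<in> P i" by blast
      obtain D where D: "diam_power s (U i) = ennreal D" "0 \<le> D"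
      proof
        show "diam_power s (U i) = ennreal (if U i = {} then 0 else if s = 0 then 1 else diameter (U i) powr s)"
          by (auto simp: diam_power_def)
      qed auto
      have "P i \<subseteq> {t0 - C * D .. t0 + C * D}"
      proof
        fix t assume t: "t \<in> P i"
        have "ennreal (dist (g t) (g t0) powr s) \<le> ennreal D"
          unfolding D(1)[symmetric] using t t0 bdd s by (intro dist_powr_le_diam_power) (auto simp: P_def)
        then have "dist (g t) (g t0) powr s \<le> D" using D(2) by simp
        then have "C * dist (g t) (g t0) powr s \<le> C * D" using C by simp
        moreover have "\<bar>t - t0\<bar> \<le> C * dist (g t) (g t0) powr s"
          using t t0 by (intro hoelder) (auto simp: P_def)
        ultimately show "t \<in> {t0 - C * D .. t0 + C * D}" by auto
      qed
      then show ?thesis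
        using C D by (intro exI[of _ "{t0 - C * D .. t0 + C * D}"]) (auto simp flip: ennreal_mult)
    qed
    then obtain J where J: "\<And>i. J i \<in> sets lborel" "\<And>i. P i \<subseteq> J i"
        "\<And>i. emeasure lborel (J i) \<le> ennreal (2 * C) * diam_power s (U i)"
      by metis
    have "{0..<1} \<subseteq> (\<Union>i. P i)"
    proof
      fix t :: real assume t: "t \<in> {0..<1}"
      then obtain i where "g t \<in> U i" using cover gE by blast
      then show "t \<in> (\<Union>i. P i)" using t by (auto simp: P_def)
    qed
    then have "{0..<1} \<subseteq> (\<Union>i. J i)" using J(2) by blast
    then have "emeasure lborel {0..<1::real} \<le> emeasure lborel (\<Union>i. J i)"
      using J(1) by (intro emeasure_mono) auto
    also have "\<dots> \<le> (\<Sum>i. emeasure lborel (J i))"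
      using J(1) by (intro emeasure_subadditive_countably) auto
    also have "\<dots> \<le> (\<Sum>i. ennreal (2 * C) * diam_power s (U i))"
      using J(3) by (intro suminf_le) auto
    also have "\<dots> = ennreal (2 * C) * (\<Sum>i. diam_power s (U i))"
      by (rule ennreal_suminf_cmult)
    finally have "1 \<le> ennreal (2 * C) * (\<Sum>i. diam_power s (U i))" by simp
    then have "ennreal (1 / (2 * C)) * 1 \<le> ennreal (1 / (2 * C)) * (ennreal (2 * C) * (\<Sum>i. diam_power s (U i)))"
      by (intro mult_left_mono) auto
    also have "\<dots> = (\<Sum>i. diam_power s (U i))"
      using C by (simp flip: mult.assoc ennreal_mult)
    finally show ?thesis by simp
  qed
  \<comment> \<open>The bound holds for covers of every mesh, so the single scale 1
    suffices.\<close>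
  have "ennreal (1 / (2 * C)) \<le> hausdorff_premeasure s 1 E"
    unfolding hausdorff_premeasure_def by (intro INF_greatest *) auto
  also have "\<dots> \<le> hausdorff_measure s E"
    unfolding hausdorff_measure_def by (intro SUP_upper) auto
  finally show ?thesis using C by auto
qed

text \<open>The intervals \<open>[c H\<^sub>i, c H\<^sub>i\<^sub>+\<^sub>1]\<close> between multiples of harmonic numbers cover \<open>[0,\<infinity>)\<close>, while
  \<open>\<Sum>i. (c / (i + 1)) powr s = O(c powr s)\<close>.\<close>

lemma hausdorff_measure_halfline_eq_0:
  fixes E :: "real set"
  assumes E: "E \<subseteq> {0..}" and s: "1 < s"
  shows "hausdorff_measure s E = 0"
proof -
  define Z where "Z = (\<Sum>i. 1 / real (Suc i) powr s)"
  have sm: "summable (\<lambda>i. 1 / real (Suc i) powr s)"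
  proof -
    have "summable (\<lambda>i. real (Suc i) powr - s)"
      using s by (subst summable_Suc_iff[where f = "\<lambda>i. real i powr - s"]) (simp add: summable_real_powr_iff)
    then show ?thesis by (simp add: powr_minus_divide)
  qed
  have Z: "0 \<le> Z" unfolding Z_def by (intro suminf_nonneg sm) auto
  \<comment> \<open>The scale \<open>c\<close> is kept apart from the mesh \<open>\<delta>\<close>:
    it tends to 0 later while \<open>\<delta>\<close> stays fixed.\<close>
  have le: "hausdorff_premeasure s \<delta> E \<le> ennreal (c powr s * Z)" if c: "0 < c" "c \<le> \<delta>" for c \<delta>
  proof -
    define H where "H i = c * harm i" for i
    define U where "U i = {H i..H (Suc i)}" for i
    have H_Suc: "H (Suc i) = H i + c / real (Suc i)" for i
      by (simp add: H_def harm_Suc field_simps)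
    have HL: "filterlim H at_top sequentially"
      unfolding H_def using c(1) by (intro filterlim_tendsto_pos_mult_at_top[OF tendsto_const] harm_at_top)
    have cover: "E \<subseteq> (\<Union>i. U i)"
    proof
      fix x assume "x \<in> E"
      then have x: "H 0 \<le> x" using E by (auto simp: H_def harm_def)
      have "\<exists>n. x < H n"
        using filterlim_at_top_dense[THEN iffD1, OF HL] by (auto simp: eventually_sequentially)
      then obtain n where "x < H n" ..
      define m where "m = (LEAST n. x < H n)"
      have m: "x < H m" unfolding m_def by (rule LeastI[of _ n]) fact
      have "m \<noteq> 0" using m x by (metis not_le)
      then obtain i where i: "m = Suc i" by (cases m) auto
      have "\<not> x < H i" using not_less_Least[of i "\<lambda>n. x < H n"] i by (auto simp: m_def)
      then have "x \<in> U i" using m i by (simp add: U_def)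
      then show "x \<in> (\<Union>i. U i)" by blast
    qed
    have diam: "diameter (U i) = c / real (Suc i)" for i
    proof -
      have "H i \<le> H (Suc i)" using c(1) by (simp add: H_Suc del: of_nat_Suc)
      then show ?thesis by (simp add: U_def) (simp add: H_Suc)
    qed
    have "diam_power s (U i) = ennreal (c powr s * (1 / real (Suc i) powr s))" for i
      using s c(1) by (auto simp: diam_power_def diam powr_divide) (simp add: U_def H_Suc)
    then have "(\<Sum>i. diam_power s (U i)) = (\<Sum>i. ennreal (c powr s * (1 / real (Suc i) powr s)))"
      by simp
    also have "\<dots> = ennreal (\<Sum>i. c powr s * (1 / real (Suc i) powr s))"
      using sm by (intro suminf_ennreal2 summable_mult) auto
    also have "\<dots> = ennreal (c powr s * Z)"
      unfolding Z_def using sm by (subst suminf_mult) auto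
    finally have eq: "(\<Sum>i. diam_power s (U i)) = ennreal (c powr s * Z)" .
    have "c / real (Suc i) \<le> \<delta>" for i
    proof -
      have "c / real (Suc i) \<le> c / 1" using c by (intro divide_left_mono) auto
      then show ?thesis using c by linarith
    qed
    then show ?thesis
      unfolding hausdorff_premeasure_def eq[symmetric]
      using cover diam by (intro INF_lower) (auto simp: U_def)
  qed
  have "hausdorff_premeasure s \<delta> E \<le> 0" if \<delta>: "0 < \<delta>" for \<delta>
  proof (rule tendsto_lowerbound)
    have "((\<lambda>c. c powr s * Z) \<longlongrightarrow> 0 powr s * Z) (at_right 0)"
      using s by (intro tendsto_intros) (auto intro: eventually_mono[OF eventually_at_right_less])
    then have "((\<lambda>c. ennreal (c powr s * Z)) \<longlongrightarrow> ennreal (0 powr s * Z)) (at_right 0)"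
      by (intro tendsto_ennrealI)
    then show "((\<lambda>c. ennreal (c powr s * Z)) \<longlongrightarrow> 0) (at_right 0)" by simp
    show "\<forall>\<^sub>F c in at_right 0. hausdorff_premeasure s \<delta> E \<le> ennreal (c powr s * Z)"
      using eventually_at_right_field[THEN iffD2] \<delta> le
      by (auto simp: eventually_at_right_field intro!: exI[of _ \<delta>])
  qed auto
  then show ?thesis
    unfolding hausdorff_measure_def by (auto simp: SUP_eq_const bot_ennreal)
qed

section \<open>Specification from a freely insertable symbol\<close>

text \<open>Prefix cylinders are open in the product of discrete spaces. Conversely, approximants
  agreeing with \<open>x\<close> on ever longer prefixes are eventually constant in each coordinate,
  hence converge.\<close>

lemma in_closure_iff_agree:
  fixes x :: "nat \<Rightarrow> 'a::discrete_topology"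
  shows "x \<in> closure S \<longleftrightarrow> (\<forall>n. \<exists>s\<in>S. \<forall>i<n. s i = x i)"
proof safe
  fix n assume x: "x \<in> closure S"
  define V where "V = (\<Inter>i\<in>{..<n}. (\<lambda>y::nat\<Rightarrow>'a. y i) -` {x i})"
  have "open V"
    unfolding V_def
    by (intro open_INT ballI open_vimage[OF open_discrete continuous_on_product_coordinates]) auto
  moreover have "x \<in> V" by (auto simp: V_def)
  ultimately obtain s where "s \<in> S" "s \<in> V"
    using x by (meson closure_iff_nhds_not_empty disjoint_iff order_refl)
  then show "\<exists>s\<in>S. \<forall>i<n. s i = x i" by (auto simp: V_def)
next
  assume "\<forall>n. \<exists>s\<in>S. \<forall>i<n. s i = x i"
  then obtain s where s: "\<And>n. s n \<in> S" "\<And>n i. i < n \<Longrightarrow> s n i = x i" by metis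
  have "limitin euclidean (\<lambda>n. s n i) (x i) sequentially" for i
  proof -
    have "\<forall>\<^sub>F n in sequentially. s n i = x i"
      using s(2) by (intro eventually_sequentiallyI[of "Suc i"]) auto
    then show ?thesis by (simp add: tendsto_eventually)
  qed
  then have "limitin (product_topology (\<lambda>_. euclidean) UNIV) s x sequentially"
    unfolding limitin_componentwise by auto
  then have "s \<longlonglongrightarrow> x"
    by (simp add: euclidean_product_topology)
  then show "x \<in> closure S"
    using s(1) closure_subset[of S] by (intro Lim_in_closed_set[OF closed_closure, of s]) (auto simp: subset_iff)
qed

lemma shift_map_funpow: "(shift_map ^^ n) x = (\<lambda>i. x (i + n))"
  by (induction n arbitrary: x) (auto simp: shift_map_def fun_eq_iff)

lemma prefix_in_language_closure:
  assumes "w \<frown> z \<in> closure S" "w \<noteq> []"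
  shows "w \<in> language (closure S)"
  using assms unfolding language_def cylinder_def by fastforce

text \<open>One more gap at the end turns the spliced word into blocks \<open>w @ v\<close>; this
  completed word is the period required by specification.\<close>

lemma concat_splice_replicate:
  "ws \<noteq> [] \<Longrightarrow> concat (splice ws (replicate (length ws - 1) v)) @ v = concat (map (\<lambda>w. w @ v) ws)"
proof (induction ws)
  case (Cons w ws)
  then show ?case by (cases ws) auto
qed simp

text \<open>Blocks \<open>w @ [c]\<close> can be put in front of a point of \<open>S\<close>
  repeatedly without leaving \<open>S\<close>. The required periodic point is a limit of points of
  \<open>S\<close> that run through finitely many periods and then follow a fixed
  \<open>z\<close>.\<close>

lemma specification_gap_if_free_symbol:
  fixes S :: "(nat \<Rightarrow> 'a::discrete_topology) set"
  assumes free: "\<And>x z n. x \<in> S \<Longrightarrow> z \<in> S \<Longrightarrow> \<exists>w. length w = n \<and> (\<forall>i<n. w ! i = x i) \<and> w \<frown> [c] \<frown> z \<in> S"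
  shows "specification_gap (closure S) 1"
  unfolding specification_gap_def
proof (intro allI impI)
  fix ws assume "ws \<noteq> [] \<and> set ws \<subseteq> language (closure S)"
  then have ws: "ws \<noteq> []" "set ws \<subseteq> language (closure S)" by auto
  \<comment> \<open>A word of the language of the closure is already a prefix of a point of
    \<open>S\<close>, so \<open>free\<close> applies and returns this very word.\<close>
  have conc1: "w \<frown> [c] \<frown> z \<in> S" if w: "w \<in> language (closure S)" and z: "z \<in> S" for w z
  proof -
    obtain y where y: "y \<in> closure S" "\<forall>i<length w. y i = w ! i"
      using w by (auto simp: language_def cylinder_def)
    obtain x where x: "x \<in> S" "\<forall>i<length w. x i = y i"
      using in_closure_iff_agree y(1) by metis
    obtain w' where w': "length w' = length w" "\<forall>i<length w. w' ! i = x i" "w' \<frown> [c] \<frown> z \<in> S"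
      using free[OF x(1) z, of "length w"] by blast
    have "w' = w" using w' x y by (intro nth_equalityI) auto
    then show ?thesis using w' by simp
  qed
  define W where "W us = concat (map (\<lambda>w. w @ [c]) us)" for us
  have concs: "W us \<frown> z \<in> S" if "set us \<subseteq> language (closure S)" "z \<in> S" for us z
    using that
  proof (induction us)
    case (Cons w us)
    then have "w \<frown> [c] \<frown> (W us \<frown> z) \<in> S" by (intro conc1) auto
    then show ?case by (simp add: W_def)
  qed (simp add: W_def)
  define vs where "vs = replicate (length ws - 1) [c]"
  define x where "x = concat (splice ws vs)"
  have xW: "x @ [c] = W ws"
    unfolding x_def vs_def W_def using ws(1) by (rule concat_splice_replicate)
  obtain y0 where "y0 \<in> closure S"
    using ws by (cases ws) (auto simp: language_def cylinder_def)
  then obtain z where z: "z \<in> S"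
    using in_closure_iff_agree by blast
  have "[c] \<in> language (closure S)"
    using free[OF z z, of 0] closure_subset[of S] by (intro prefix_in_language_closure[of _ z]) auto
  moreover have "x \<noteq> []"
  proof
    assume "x = []"
    obtain w ws' where ws': "ws = w # ws'" using ws(1) by (cases ws) auto
    then have "w \<noteq> []" using ws(2) by (auto simp: language_def)
    then show False using \<open>x = []\<close> xW ws' by (cases w) (auto simp: W_def)
  qed
  define y where "y = (W ws)\<^sup>\<omega>"
  have W_ne: "0 < length (W ws)" using xW by (metis append_is_Nil_conv length_greater_0_conv not_Cons_self2)
  \<comment> \<open>Repeating the list \<open>ws\<close> yields whole periods, so
    \<open>concs\<close> covers any number of them.\<close>
  have unroll: "W (concat (replicate r ws)) \<frown> y = y" for r
  proof (induction r)
    case (Suc r)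
    have "W (concat (replicate (Suc r) ws)) \<frown> y = W ws \<frown> (W (concat (replicate r ws)) \<frown> y)"
      by (simp add: W_def)
    also have "\<dots> = W ws \<frown> y" by (simp only: Suc)
    also have "\<dots> = y" unfolding y_def by (rule iter_unroll[OF W_ne, symmetric])
    finally show ?case .
  qed (simp add: W_def)
  have len: "length (W (concat (replicate r ws))) \<ge> r" for r
  proof (induction r)
    case (Suc r)
    have split: "W (concat (replicate (Suc r) ws)) = W ws @ W (concat (replicate r ws))"
      by (simp add: W_def)
    show ?case unfolding split length_append using Suc W_ne by linarith
  qed simp
  \<comment> \<open>Since \<open>W ws\<close> is nonempty, \<open>n\<close> periods followed by
    \<open>z\<close> agree with \<open>y\<close> on the first \<open>n\<close> symbols.\<close>
  have y_clos: "y \<in> closure S"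
    unfolding in_closure_iff_agree
  proof
    fix n
    have "W (concat (replicate n ws)) \<frown> z \<in> S"
      using ws z by (intro concs) (auto split: if_splits)
    moreover have "(W (concat (replicate n ws)) \<frown> z) i = y i" if "i < n" for i
      using unroll[of n] len[of n] that by (metis conc_fst dual_order.strict_trans1)
    ultimately show "\<exists>s\<in>S. \<forall>i<n. s i = y i" by blast
  qed
  have y_x: "y = x \<frown> [c] \<frown> y"
    using iter_unroll[OF W_ne] unfolding y_def xW[symmetric] by (simp only: conc_conc)
  have "x \<in> language (closure S)"
    using y_clos y_x \<open>x \<noteq> []\<close> by (metis prefix_in_language_closure)
  moreover have "y \<in> cylinder (closure S) x"
  proof -
    have "y i = x ! i" if "i < length x" for i
      using fun_cong[OF y_x, of i] that by simp
    then show ?thesis using y_clos by (simp add: cylinder_def)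
  qed
  moreover have "(shift_map ^^ (length x + 1)) y = y"
  proof -
    have len_W: "length x + 1 = length (W ws)" using arg_cong[OF xW, of length] by simp
    show ?thesis unfolding len_W shift_map_funpow y_def using W_ne by (intro ext) simp
  qed
  ultimately show "\<exists>vs. length vs = length ws - 1 \<and> set vs \<subseteq> language (closure S) \<and> (\<forall>v\<in>set vs. length v = 1) \<and>
      (let x = concat (splice ws vs) in x \<in> language (closure S) \<and>
         (\<exists>y\<in>cylinder (closure S) x. (shift_map ^^ (length x + 1)) y = y))"
    by (intro exI[of _ vs]) (auto simp: Let_def vs_def x_def)
qed

section \<open>Codings as integer parts, and images of cylinders\<close>

lemma in_branch_interval_iff:
  assumes "0 \<le> \<alpha>" "\<alpha> < 1" "1 < \<beta>" "x \<in> {0..<1}" "j < num_symbols \<alpha> \<beta>"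
  shows "x \<in> branch_interval \<alpha> \<beta> j \<longleftrightarrow> j = nat \<lfloor>\<beta> * x + \<alpha>\<rfloor>"
proof -
  let ?y = "\<beta> * x + \<alpha>"
  have y0: "0 \<le> ?y" using assms by auto
  have "?y < \<alpha> + \<beta>" using assms by auto
  also have "\<dots> \<le> real (num_symbols \<alpha> \<beta>)" unfolding num_symbols_def by linarith
  finally have yk: "?y < real (num_symbols \<alpha> \<beta>)" .
  have lower: "(real j - \<alpha>) / \<beta> \<le> x \<longleftrightarrow> real j \<le> ?y" for j
    using assms by (simp add: divide_le_eq algebra_simps)
  have upper: "x < (real j + 1 - \<alpha>) / \<beta> \<longleftrightarrow> ?y < real j + 1" for j
    using assms by (simp add: less_divide_eq algebra_simps)
  have fl: "j = nat \<lfloor>?y\<rfloor> \<longleftrightarrow> real j \<le> ?y \<and> ?y < real j + 1"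
    using y0 by linarith
  \<comment> \<open>At the two extreme indices one inequality is not an end point condition of the
    branch; \<open>y0\<close> or \<open>yk\<close> supplies it.\<close>
  consider "j = 0" | "j \<noteq> 0" "j = num_symbols \<alpha> \<beta> - 1" | "j \<noteq> 0" "j \<noteq> num_symbols \<alpha> \<beta> - 1" by blast
  then show ?thesis
  proof cases
    case 1
    then show ?thesis using upper[of 0] fl y0 assms by (simp add: branch_interval_def)
  next
    case 2
    then have "real (num_symbols \<alpha> \<beta>) = real j + 1" using assms(5) by linarith
    then show ?thesis using 2 lower[of j] fl yk assms by (simp add: branch_interval_def)
  next
    case 3
    then show ?thesis using lower[of j] upper[of j] fl assms by (simp add: branch_interval_def)
  qed
qed

lemma T_ab_in_unit: "T_ab \<alpha> \<beta> x \<in> {0..<1}"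
  using frac_ge_0[of "\<beta> * x + \<alpha>"] frac_lt_1[of "\<beta> * x + \<alpha>"]
  by (auto simp only: T_ab_def frac_def atLeastLessThan_iff)

lemma T_ab_funpow_in_unit: "x \<in> {0..<1} \<Longrightarrow> (T_ab \<alpha> \<beta> ^^ n) x \<in> {0..<1}"
  using T_ab_in_unit by (cases n) auto

lemma coding_eq_floor:
  assumes "0 \<le> \<alpha>" "\<alpha> < 1" "1 < \<beta>" "x \<in> {0..<1}"
  shows "coding \<alpha> \<beta> x n = nat \<lfloor>\<beta> * (T_ab \<alpha> \<beta> ^^ n) x + \<alpha>\<rfloor>"
proof -
  define y where "y = (T_ab \<alpha> \<beta> ^^ n) x"
  have y: "y \<in> {0..<1}" unfolding y_def by (rule T_ab_funpow_in_unit) fact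
  have "\<beta> * y + \<alpha> < \<beta> + \<alpha>" "0 \<le> \<beta> * y + \<alpha>" using y assms by auto
  moreover have "\<beta> + \<alpha> \<le> real (num_symbols \<alpha> \<beta>)" unfolding num_symbols_def by linarith
  ultimately have "nat \<lfloor>\<beta> * y + \<alpha>\<rfloor> < num_symbols \<alpha> \<beta>" by linarith
  then show ?thesis
    unfolding coding_def y_def[symmetric]
    by (intro the_equality) (use in_branch_interval_iff assms y in auto)
qed

lemma coding_T_ab_funpow: "coding \<alpha> \<beta> ((T_ab \<alpha> \<beta> ^^ m) x) n = coding \<alpha> \<beta> x (n + m)"
  unfolding coding_def by (simp add: funpow_add)

lemma T_ab_eq: "of_int j \<le> \<beta> * x + \<alpha> \<Longrightarrow> \<beta> * x + \<alpha> < of_int j + 1 \<Longrightarrow> T_ab \<alpha> \<beta> x = \<beta> * x + \<alpha> - of_int j"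
  unfolding T_ab_def by (simp add: floor_unique)

text \<open>The image under \<open>T\<^sup>n\<close> of a cylinder of length \<open>n\<close> is an interval whose left end lies on the orbit of
  \<open>0\<close> and whose right end lies on the orbit of \<open>1\<close> under the left-continuous version of \<open>T\<close>.
  \<open>A\<close> and \<open>B\<close> stand for any sets containing these orbits.\<close>

lemma cylinder_image:
  fixes A B :: "real set"
  assumes ab: "0 \<le> \<alpha>" "\<alpha> < 1" "1 < \<beta>"
    and A: "0 \<in> A" "A \<subseteq> {0..}" "\<And>a. a \<in> A \<Longrightarrow> T_ab \<alpha> \<beta> a \<in> A"
    and B: "1 \<in> B" "B \<subseteq> {..1}"
      "\<And>b j. b \<in> B \<Longrightarrow> of_int j < \<beta> * b + \<alpha> \<Longrightarrow> \<beta> * b + \<alpha> \<le> of_int j + 1 \<Longrightarrow> \<beta> * b + \<alpha> - of_int j \<in> B"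
    and x: "x \<in> {0..<1}"
  shows "\<exists>a\<in>A. \<exists>b\<in>B. (T_ab \<alpha> \<beta> ^^ n) x \<in> {a..<b} \<and>
    (\<forall>y\<in>{a..<b}. \<exists>x'\<in>{0..<1}. (T_ab \<alpha> \<beta> ^^ n) x' = y \<and> (\<forall>i<n. coding \<alpha> \<beta> x' i = coding \<alpha> \<beta> x i))"
proof (induction n)
  case 0
  show ?case using A(1) B(1) x by (intro bexI[of _ 0] bexI[of _ 1]) auto
next
  case (Suc n)
  define z where "z = (T_ab \<alpha> \<beta> ^^ n) x"
  have z01: "z \<in> {0..<1}" unfolding z_def by (rule T_ab_funpow_in_unit) fact
  from Suc obtain a b where a: "a \<in> A" "a \<le> z" and b: "b \<in> B" "z < b"
    and pre: "\<And>y. a \<le> y \<Longrightarrow> y < b \<Longrightarrow> \<exists>x'\<in>{0..<1}. (T_ab \<alpha> \<beta> ^^ n) x' = y \<and> (\<forall>i<n. coding \<alpha> \<beta> x' i = coding \<alpha> \<beta> x i)"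
    unfolding z_def by fastforce
  define j where "j = \<lfloor>\<beta> * z + \<alpha>\<rfloor>"
  have j: "of_int j \<le> \<beta> * z + \<alpha>" "\<beta> * z + \<alpha> < of_int j + 1" unfolding j_def by linarith+
  have az: "\<beta> * a + \<alpha> \<le> \<beta> * z + \<alpha>" and bz: "\<beta> * z + \<alpha> < \<beta> * b + \<alpha>" using a b ab by auto
  \<comment> \<open>The new interval is the image of the part of [a,b) in branch \<open>j\<close>.
    An end cut off by the branch becomes 0 or 1, any other end moves along its orbit. A right end
    exactly at \<open>of_int j + 1\<close> still counts as inside, which is the left-continuous
    convention.\<close>
  define a' where "a' = (if of_int j \<le> \<beta> * a + \<alpha> then \<beta> * a + \<alpha> - of_int j else 0)"
  define b' where "b' = (if \<beta> * b + \<alpha> \<le> of_int j + 1 then \<beta> * b + \<alpha> - of_int j else 1)"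
  have a': "a' \<in> A"
    using A(3)[OF a(1)] A(1) az j T_ab_eq[of j \<beta> a \<alpha>] by (auto simp: a'_def)
  have b': "b' \<in> B"
    using B(3)[OF b(1), of j] B(1) bz j by (auto simp: b'_def)
  have Tz: "(T_ab \<alpha> \<beta> ^^ Suc n) x = \<beta> * z + \<alpha> - of_int j"
    using j T_ab_eq[of j \<beta> z \<alpha>] by (simp add: z_def)
  have "(T_ab \<alpha> \<beta> ^^ Suc n) x \<in> {a'..<b'}"
    unfolding Tz using az bz j by (auto simp: a'_def b'_def)
  moreover have "\<exists>x'\<in>{0..<1}. (T_ab \<alpha> \<beta> ^^ Suc n) x' = y \<and> (\<forall>i<Suc n. coding \<alpha> \<beta> x' i = coding \<alpha> \<beta> x i)"
    if y: "y \<in> {a'..<b'}" for y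
  proof -
    have y01: "0 \<le> y" "y < 1"
      using y a' A(2) b' B(2) by auto
    \<comment> \<open>The preimage of \<open>y\<close> in branch \<open>j\<close>; it lies in [a,b),
      so the induction hypothesis provides the prefix.\<close>
    define p where "p = (y + of_int j - \<alpha>) / \<beta>"
    have p: "\<beta> * p + \<alpha> = y + of_int j" using ab by (simp add: p_def)
    have "\<beta> * a + \<alpha> \<le> \<beta> * p + \<alpha>" "\<beta> * p + \<alpha> < \<beta> * b + \<alpha>"
      unfolding p using y y01 by (auto simp: a'_def b'_def split: if_splits)
    then have "a \<le> p" "p < b" using ab by auto
    from pre[OF this] obtain x' where x': "x' \<in> {0..<1}" "(T_ab \<alpha> \<beta> ^^ n) x' = p"
      "\<forall>i<n. coding \<alpha> \<beta> x' i = coding \<alpha> \<beta> x i" by blast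
    have fl: "\<lfloor>\<beta> * p + \<alpha>\<rfloor> = j" unfolding p using y01 by linarith
    have "(T_ab \<alpha> \<beta> ^^ Suc n) x' = y" using x'(2) p fl by (simp add: T_ab_def)
    moreover have "coding \<alpha> \<beta> x' n = coding \<alpha> \<beta> x n"
      using x fl x'(1,2) ab by (simp add: coding_eq_floor j_def z_def)
    ultimately show ?thesis using x' by (auto simp: less_Suc_eq)
  qed
  ultimately show ?case using a' b' by blast
qed

text \<open>By \<open>Ac\<close> and \<open>Bc\<close> the branch of \<open>c\<close> lies inside
  every [a,b) with \<open>a\<close> in \<open>A\<close> and \<open>b\<close> in \<open>B\<close>,
  hence inside the image of every cylinder. That branch maps onto [0,1), so \<open>c\<close> fits
  between any word and any coding.\<close>

lemma specification_if_separating_symbol: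
  fixes A B :: "real set" and c :: nat
  assumes ab: "0 \<le> \<alpha>" "\<alpha> < 1" "1 < \<beta>"
    and A: "0 \<in> A" "A \<subseteq> {0..}" "\<And>a. a \<in> A \<Longrightarrow> T_ab \<alpha> \<beta> a \<in> A"
    and B: "1 \<in> B" "B \<subseteq> {..1}"
      "\<And>b j. b \<in> B \<Longrightarrow> of_int j < \<beta> * b + \<alpha> \<Longrightarrow> \<beta> * b + \<alpha> \<le> of_int j + 1 \<Longrightarrow> \<beta> * b + \<alpha> - of_int j \<in> B"
    and Ac: "\<And>a. a \<in> A \<Longrightarrow> \<beta> * a + \<alpha> \<le> real c"
    and Bc: "\<And>b. b \<in> B \<Longrightarrow> real c + 1 \<le> \<beta> * b + \<alpha>"
  shows "specification_property (ab_shift \<alpha> \<beta>)"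
proof -
  have "\<exists>w. length w = n \<and> (\<forall>i<n. w ! i = s i) \<and> w \<frown> [c] \<frown> t \<in> coding \<alpha> \<beta> ` {0..<1}"
    if st: "s \<in> coding \<alpha> \<beta> ` {0..<1}" "t \<in> coding \<alpha> \<beta> ` {0..<1}" for s t :: "nat \<Rightarrow> nat" and n
  proof -
    from st obtain x z where x: "x \<in> {0..<1}" "s = coding \<alpha> \<beta> x" and z: "z \<in> {0..<1}" "t = coding \<alpha> \<beta> z"
      by blast
    obtain a b where a: "a \<in> A" and b: "b \<in> B" and pre: "\<And>y. y \<in> {a..<b} \<Longrightarrow>
        \<exists>x'\<in>{0..<1}. (T_ab \<alpha> \<beta> ^^ n) x' = y \<and> (\<forall>i<n. coding \<alpha> \<beta> x' i = coding \<alpha> \<beta> x i)"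
      using cylinder_image[OF ab A B x(1), of n] by blast
    define p where "p = (z + real c - \<alpha>) / \<beta>"
    have p: "\<beta> * p + \<alpha> = z + real c" using ab by (simp add: p_def)
    have "\<beta> * a + \<alpha> \<le> \<beta> * p + \<alpha>" "\<beta> * p + \<alpha> < \<beta> * b + \<alpha>"
      unfolding p using Ac[OF a] Bc[OF b] z by auto
    then have "p \<in> {a..<b}" using ab by auto
    from pre[OF this] obtain x' where x': "x' \<in> {0..<1}" "(T_ab \<alpha> \<beta> ^^ n) x' = p"
      "\<forall>i<n. coding \<alpha> \<beta> x' i = coding \<alpha> \<beta> x i" by blast
    have fl: "\<lfloor>\<beta> * p + \<alpha>\<rfloor> = int c" unfolding p using z by (auto intro: floor_unique)
    have Tp: "T_ab \<alpha> \<beta> p = z" using p fl by (simp add: T_ab_def)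
    have cn: "coding \<alpha> \<beta> x' n = c" using x' fl ab by (simp add: coding_eq_floor)
    have tail: "coding \<alpha> \<beta> x' (i + Suc n) = t i" for i
      using coding_T_ab_funpow[of \<alpha> \<beta> "Suc n" x' i] x'(2) Tp z(2) by simp
    define w where "w = map s [0..<n]"
    have "coding \<alpha> \<beta> x' i = (w \<frown> [c] \<frown> t) i" for i
    proof -
      consider "i < n" | "i = n" | m where "i = m + Suc n"
        by (metis add.commute less_iff_Suc_add linorder_less_linear add_Suc_right)
      then show ?thesis
        by cases (use x' x cn tail in \<open>auto simp: w_def conc_def nth_append\<close>)
    qed
    then have "coding \<alpha> \<beta> x' = w \<frown> [c] \<frown> t" by blast
    then have "w \<frown> [c] \<frown> t \<in> coding \<alpha> \<beta> ` {0..<1}" using x'(1) by (metis imageI)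
    then show ?thesis by (intro exI[of _ w]) (simp add: w_def)
  qed
  then have "specification_gap (ab_shift \<alpha> \<beta>) 1"
    unfolding ab_shift_def by (intro specification_gap_if_free_symbol[where c = c]) blast
  then show ?thesis unfolding specification_property_def by blast
qed

section \<open>Expansions in a real base\<close>

text \<open>Digits are real so that differences of digit sequences, possibly negative, can be
  expanded too.\<close>

definition expansion :: "real \<Rightarrow> (nat \<Rightarrow> real) \<Rightarrow> real" where
  "expansion \<beta> e = (\<Sum>j. e j / \<beta> ^ (j + 1))"

lemma const_expansion_sums:
  fixes B \<beta> :: real
  assumes "1 < \<beta>"
  shows "(\<lambda>j. B / \<beta> ^ (j + 1)) sums (B / (\<beta> - 1))"
proof -
  have "(\<lambda>j. (B / \<beta>) * (1 / \<beta>) ^ j) sums ((B / \<beta>) * (1 / (1 - 1 / \<beta>)))"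
    using assms by (intro sums_mult geometric_sums) auto
  moreover have "(B / \<beta>) * (1 / (1 - 1 / \<beta>)) = B / (\<beta> - 1)"
    using assms by (simp add: divide_simps)
  moreover have "(\<lambda>j. (B / \<beta>) * (1 / \<beta>) ^ j) = (\<lambda>j. B / \<beta> ^ (j + 1))"
    by (simp add: power_divide)
  ultimately show ?thesis by (simp only:)
qed

lemma expansion_const: "1 < \<beta> \<Longrightarrow> expansion \<beta> (\<lambda>_. B) = B / (\<beta> - 1)"
  unfolding expansion_def by (rule sums_unique[OF const_expansion_sums, symmetric])

lemma summable_expansion:
  fixes \<beta> :: real
  assumes "1 < \<beta>" "\<And>j. \<bar>e j\<bar> \<le> B"
  shows "summable (\<lambda>j. e j / \<beta> ^ (j + 1))"
proof (rule summable_comparison_test')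
  show "summable (\<lambda>j. B / \<beta> ^ (j + 1))"
    using const_expansion_sums[OF assms(1)] by (rule sums_summable)
  show "norm (e j / \<beta> ^ (j + 1)) \<le> B / \<beta> ^ (j + 1)" for j
    using assms by (simp add: abs_mult divide_right_mono power_abs)
qed

lemma expansion_mono:
  assumes "1 < \<beta>" "\<And>j. \<bar>e j\<bar> \<le> B" "\<And>j. \<bar>f j\<bar> \<le> B'" "\<And>j. e j \<le> f j"
  shows "expansion \<beta> e \<le> expansion \<beta> f"
  unfolding expansion_def using assms
  by (intro suminf_le divide_right_mono summable_expansion[of \<beta> e B] summable_expansion[of \<beta> f B']) auto

lemma expansion_le:
  assumes "1 < \<beta>" "\<And>j. \<bar>e j\<bar> \<le> B" "\<And>j. e j \<le> b"
  shows "expansion \<beta> e \<le> b / (\<beta> - 1)"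
  using expansion_mono[of \<beta> e B "\<lambda>_. b" "\<bar>b\<bar>"] assms by (simp add: expansion_const)

lemma expansion_ge:
  assumes "1 < \<beta>" "\<And>j. \<bar>e j\<bar> \<le> B" "\<And>j. b \<le> e j"
  shows "b / (\<beta> - 1) \<le> expansion \<beta> e"
  using expansion_mono[of \<beta> "\<lambda>_. b" "\<bar>b\<bar>" e B] assms by (simp add: expansion_const)

lemma expansion_diff:
  assumes "1 < \<beta>" "\<And>j. \<bar>e j\<bar> \<le> B" "\<And>j. \<bar>f j\<bar> \<le> B'"
  shows "expansion \<beta> (\<lambda>j. e j - f j) = expansion \<beta> e - expansion \<beta> f"
  unfolding expansion_def diff_divide_distrib using assms
  by (intro suminf_diff[symmetric] summable_expansion[of \<beta> e B] summable_expansion[of \<beta> f B'])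

lemma expansion_Suc:
  assumes "1 < \<beta>" "\<And>j. \<bar>e j\<bar> \<le> B"
  shows "\<beta> * expansion \<beta> e = e 0 + expansion \<beta> (\<lambda>j. e (Suc j))"
proof -
  have "(\<Sum>j. e (Suc j) / \<beta> ^ (Suc j + 1)) = expansion \<beta> e - e 0 / \<beta>"
    unfolding expansion_def using suminf_split_head[OF summable_expansion[OF assms]] by simp
  moreover have "\<beta> * (\<Sum>j. e (Suc j) / \<beta> ^ (Suc j + 1)) = expansion \<beta> (\<lambda>j. e (Suc j))"
  proof -
    have "summable (\<lambda>j. e (Suc j) / \<beta> ^ (Suc j + 1))"
      using summable_expansion[OF assms] by (subst summable_Suc_iff)
    then show ?thesis
      unfolding expansion_def using assms by (subst suminf_mult[symmetric]) auto
  qed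
  ultimately have "\<beta> * (expansion \<beta> e - e 0 / \<beta>) = expansion \<beta> (\<lambda>j. e (Suc j))" by (simp only:)
  then show ?thesis using assms(1) by (simp add: right_diff_distrib)
qed

text \<open>A leading digit of at least 1 competes with a tail that is at worst constantly
  \<open>- B\<close>. For \<open>B < \<beta> - 1\<close> lexicographic order thus forces numerical
  order, with an explicit gap.\<close>

lemma expansion_lex_ge:
  assumes "1 < \<beta>" "\<And>j. \<bar>e j\<bar> \<le> B'" "\<And>j. j < n \<Longrightarrow> e j = 0" "1 \<le> e n" "\<And>j. n < j \<Longrightarrow> - B \<le> e j"
  shows "(1 - B / (\<beta> - 1)) / \<beta> ^ (n + 1) \<le> expansion \<beta> e"
  using assms(2-)
proof (induction n arbitrary: e)
  case 0
  have "- B / (\<beta> - 1) \<le> expansion \<beta> (\<lambda>j. e (Suc j))"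
    using 0 assms(1) by (intro expansion_ge[where B = B']) auto
  then have "1 - B / (\<beta> - 1) \<le> \<beta> * expansion \<beta> e"
    using expansion_Suc[OF assms(1) 0(1)] 0(3) by simp
  then show ?case using assms(1) by (simp add: divide_le_eq mult.commute)
next
  case (Suc n)
  have "(1 - B / (\<beta> - 1)) / \<beta> ^ (n + 1) \<le> expansion \<beta> (\<lambda>j. e (Suc j))"
    using Suc by auto
  also have "\<dots> = \<beta> * expansion \<beta> e"
    using expansion_Suc[OF assms(1) Suc(2)] Suc(3)[of 0] by simp
  finally show ?case using assms(1) by (simp add: divide_le_eq mult_ac)
qed

section \<open>Dependence of expansions on the base\<close>

lemma abs_power_diff_le:
  fixes x y q :: real
  assumes "\<bar>x\<bar> \<le> q" "\<bar>y\<bar> \<le> q"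
  shows "\<bar>x ^ Suc j - y ^ Suc j\<bar> \<le> real (Suc j) * q ^ j * \<bar>x - y\<bar>"
proof (induction j)
  case (Suc j)
  have q: "0 \<le> q" using assms by linarith
  have "x ^ Suc (Suc j) - y ^ Suc (Suc j) = x * (x ^ Suc j - y ^ Suc j) + y ^ Suc j * (x - y)"
    by (simp add: algebra_simps)
  then have "\<bar>x ^ Suc (Suc j) - y ^ Suc (Suc j)\<bar> \<le> \<bar>x\<bar> * \<bar>x ^ Suc j - y ^ Suc j\<bar> + \<bar>y\<bar> ^ Suc j * \<bar>x - y\<bar>"
    by (metis abs_mult abs_triangle_ineq power_abs)
  also have "\<dots> \<le> q * (real (Suc j) * q ^ j * \<bar>x - y\<bar>) + q ^ Suc j * \<bar>x - y\<bar>"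
    using assms q Suc by (intro add_mono mult_mono power_mono) auto
  also have "\<dots> = real (Suc (Suc j)) * q ^ Suc j * \<bar>x - y\<bar>"
    by (simp add: algebra_simps)
  finally show ?case .
qed simp

text \<open>The expansion is a power series in \<open>1 / \<beta>\<close>, which is at most 1/2; the
  factor 4 is the sum of \<open>(j + 1) / 2^j\<close>, and inversion does not increase distances
  here.\<close>

lemma expansion_lipschitz:
  assumes "2 \<le> \<beta>" "2 \<le> \<beta>'" "\<And>j. \<bar>e j\<bar> \<le> B"
  shows "\<bar>expansion \<beta> e - expansion \<beta>' e\<bar> \<le> 4 * B * \<bar>\<beta> - \<beta>'\<bar>"
proof -
  define D where "D = \<bar>\<beta> - \<beta>'\<bar>"
  have B: "0 \<le> B" using assms(3)[of 0] by linarith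
  have "\<bar>1 / \<beta> - 1 / \<beta>'\<bar> = D / (\<beta> * \<beta>')"
    using assms by (simp add: D_def divide_simps abs_if)
  also have "\<dots> \<le> D / 1"
    using assms mult_mono[of 1 \<beta> 1 \<beta>'] by (intro divide_left_mono) (auto simp: D_def)
  finally have xy: "\<bar>1 / \<beta> - 1 / \<beta>'\<bar> \<le> D" by simp
  define g where "g j = B * D * (real (Suc j) * (1 / 2) ^ j)" for j
  have g: "g sums (B * D * 4)"
    unfolding g_def using geometric_deriv_sums[of "1 / 2 :: real"]
    by (intro sums_mult) (simp add: power2_eq_square)
  have sm: "summable (\<lambda>j. e j / \<beta> ^ (j + 1))" "summable (\<lambda>j. e j / \<beta>' ^ (j + 1))"
    by (intro summable_expansion[where B = B]; use assms in force)+
  have "expansion \<beta> e - expansion \<beta>' e = (\<Sum>j. e j / \<beta> ^ (j + 1) - e j / \<beta>' ^ (j + 1))"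
    unfolding expansion_def using sm by (rule suminf_diff)
  also have "norm \<dots> \<le> (\<Sum>j. g j)"
  proof (rule norm_suminf_le)
    fix j
    have "\<bar>e j / \<beta> ^ (j + 1) - e j / \<beta>' ^ (j + 1)\<bar> = \<bar>e j\<bar> * \<bar>(1 / \<beta>) ^ Suc j - (1 / \<beta>') ^ Suc j\<bar>"
      by (simp add: power_divide right_diff_distrib flip: abs_mult)
    also have "\<dots> \<le> B * (real (Suc j) * (1 / 2) ^ j * \<bar>1 / \<beta> - 1 / \<beta>'\<bar>)"
      using assms by (intro mult_mono abs_power_diff_le) (auto simp: divide_simps B)
    also have "\<dots> \<le> B * (real (Suc j) * (1 / 2) ^ j * D)"
      using xy B by (intro mult_left_mono) auto
    finally show "norm (e j / \<beta> ^ (j + 1) - e j / \<beta>' ^ (j + 1)) \<le> g j"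
      by (simp add: g_def mult_ac)
  qed (use g sums_summable in blast)
  also have "\<dots> = 4 * B * \<bar>\<beta> - \<beta>'\<bar>" using g by (simp add: sums_iff D_def)
  finally show ?thesis by simp
qed

text \<open>Intermediate values: at base \<open>N\<close> the leading digit alone contributes 1 and
  the tail is positive; at base \<open>N + 1\<close> the shifted tail is below 1, too small to reach
  1.\<close>

lemma exists_expansion_eq_1:
  fixes e :: "nat \<Rightarrow> real"
  assumes N: "2 \<le> N" and e0: "e 0 = N" and e: "\<And>j. 0 < j \<Longrightarrow> 1 \<le> e j \<and> e j \<le> N - 1"
  shows "\<exists>\<beta>\<in>{N<..<N + 1}. expansion \<beta> e = 1"
proof -
  have e_le: "\<bar>e j\<bar> \<le> N" for j using e0 N e[of j] by (cases "j = 0") auto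
  have "continuous_on {N..N + 1} (\<lambda>\<beta>. expansion \<beta> e)"
  proof (rule lipschitz_on_continuous_on[of "4 * N"], rule lipschitz_onI)
    show "dist (expansion x e) (expansion y e) \<le> 4 * N * dist x y" if "x \<in> {N..N + 1}" "y \<in> {N..N + 1}" for x y
      using that N e_le unfolding dist_real_def by (intro expansion_lipschitz) auto
  qed (use N in auto)
  have "1 < expansion N e"
  proof -
    have "1 / (N - 1) \<le> expansion N (\<lambda>j. e (Suc j))"
      using N e e_le by (intro expansion_ge[where B = N]) auto
    moreover have "0 < 1 / (N - 1)" using N by simp
    ultimately have "0 < expansion N (\<lambda>j. e (Suc j))" by linarith
    then have "N < N * expansion N e"
      using expansion_Suc[of N e N] N e0 e_le by auto
    then show ?thesis using N by simp
  qed
  moreover have "expansion (N + 1) e < 1"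
  proof -
    have "expansion (N + 1) (\<lambda>j. e (Suc j)) \<le> (N - 1) / (N + 1 - 1)"
      using N e e_le by (intro expansion_le[where B = N]) auto
    also have "\<dots> < 1" using N by simp
    finally have "(N + 1) * expansion (N + 1) e < (N + 1) * 1"
      using expansion_Suc[of "N + 1" e N] N e0 e_le by auto
    then show ?thesis using N by simp
  qed
  ultimately obtain \<beta> where \<beta>: "N \<le> \<beta>" "\<beta> \<le> N + 1" "expansion \<beta> e = 1"
    using IVT2'[of "\<lambda>\<beta>. expansion \<beta> e" "N + 1" 1 N] \<open>continuous_on _ _\<close> by fastforce
  then have "\<beta> \<noteq> N" "\<beta> \<noteq> N + 1" using \<open>1 < expansion N e\<close> \<open>expansion (N + 1) e < 1\<close> by auto
  then show ?thesis using \<beta> by force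
qed

text \<open>Both expansions equal 1, so the expansion of \<open>e' - e\<close> at
  \<open>\<beta>'\<close> equals the change of the expansion of \<open>e\<close> between the two
  bases. The lexicographic gap bounds it below, the Lipschitz estimate above.\<close>

lemma expansion_roots_separated:
  assumes N: "2 \<le> N" and \<beta>: "\<beta> \<in> {N<..<N + 1}" "expansion \<beta> e = 1" and \<beta>': "\<beta>' \<in> {N<..<N + 1}" "expansion \<beta>' e' = 1"
    and bdd: "\<And>j. \<bar>e j\<bar> \<le> N" "\<And>j. \<bar>e' j\<bar> \<le> N"
    and close: "\<And>j. \<bar>e j - e' j\<bar> \<le> N - 3"
    and agree: "\<And>j. j < n \<Longrightarrow> e j = e' j" and differ: "1 \<le> \<bar>e n - e' n\<bar>"
  shows "1 / (4 * N ^ 2 * (N + 1)) / (N + 1) ^ n \<le> \<bar>\<beta> - \<beta>'\<bar>"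
proof -
  \<comment> \<open>The case where \<open>e'\<close> has the larger digit at \<open>n\<close>; the
    other follows by exchanging the roots.\<close>
  have *: "1 / (4 * N ^ 2 * (N + 1)) / (N + 1) ^ n \<le> \<bar>\<beta> - \<beta>'\<bar>"
    if N: "2 \<le> N" and \<beta>: "\<beta> \<in> {N<..<N + 1}" "expansion \<beta> e = 1" and \<beta>': "\<beta>' \<in> {N<..<N + 1}" "expansion \<beta>' e' = 1"
    and bdd: "\<And>j. \<bar>e j\<bar> \<le> N" "\<And>j. \<bar>e' j\<bar> \<le> N"
    and close: "\<And>j. \<bar>e j - e' j\<bar> \<le> N - 3"
    and agree: "\<And>j. j < n \<Longrightarrow> e j = e' j" and differ: "1 \<le> e' n - e n" for e e' \<beta> \<beta>'
  proof -
    have gap: "- (N - 3) \<le> e' j - e j" for j using close[of j] by linarith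
    \<comment> \<open>The tail loses at most \<open>(N - 3) / (\<beta>' - 1)\<close>, which is at
      most \<open>1 - 1 / N\<close>.\<close>
    have "1 / N / (N + 1) ^ (n + 1) \<le> (1 - (N - 3) / (\<beta>' - 1)) / \<beta>' ^ (n + 1)"
    proof (intro frac_le power_mono)
      have "(N - 3) / (\<beta>' - 1) \<le> (N - 1) / N" 
      proof -
        have "(N - 3) * N \<le> (N - 1) * (N - 1)" using N by (simp add: algebra_simps)
        also have "\<dots> \<le> (N - 1) * (\<beta>' - 1)" using N \<beta>' by (intro mult_left_mono) auto
        finally show ?thesis using N \<beta>' by (simp add: divide_simps)
      qed
      then show "1 / N \<le> 1 - (N - 3) / (\<beta>' - 1)" using N by (simp add: diff_divide_distrib)
      then show "0 \<le> 1 - (N - 3) / (\<beta>' - 1)" using N by (smt (verit) divide_nonneg_nonneg)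
    qed (use N \<beta>' in auto)
    also have "\<dots> \<le> expansion \<beta>' (\<lambda>j. e' j - e j)"
      using N \<beta>' agree differ close gap by (intro expansion_lex_ge[where B' = "N - 3"]) (auto simp: abs_minus_commute)
    also have "\<dots> = expansion \<beta> e - expansion \<beta>' e"
      using N \<beta> \<beta>' bdd by (subst expansion_diff[of _ _ N _ N]) auto
    also have "\<dots> \<le> 4 * N * \<bar>\<beta> - \<beta>'\<bar>"
      using expansion_lipschitz[of \<beta> \<beta>' e N] N \<beta>(1) \<beta>'(1) bdd by fastforce
    finally show ?thesis using N by (simp add: divide_simps power2_eq_square) (simp add: algebra_simps)
  qed
  show ?thesis
  proof (cases "e n \<le> e' n")
    case True
    then show ?thesis using assms by (intro *[of \<beta> e \<beta>' e']) auto
  next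
    case False
    then have "1 / (4 * N ^ 2 * (N + 1)) / (N + 1) ^ n \<le> \<bar>\<beta>' - \<beta>\<bar>"
      using assms by (intro *[of \<beta>' e' \<beta> e]) (auto simp: abs_minus_commute)
    then show ?thesis by (simp add: abs_minus_commute)
  qed
qed

section \<open>Parameters with restricted upper kneading sequence\<close>

text \<open>Since \<open>\<alpha> = (\<beta> - 1) * S\<close>, in the coordinate
  \<open>x + S\<close> the transformation is multiplication by \<beta> minus a digit. The orbits of
  0 and 1 therefore become expansions of the tails of \<open>u\<close> and \<open>v\<close>, shifted
  by \<open>S\<close>.\<close>

lemma specification_if_restricted_digits:
  fixes u d :: "nat \<Rightarrow> nat" and N K :: nat
  assumes u0: "u 0 = 0" and u_lex: "\<And>n. lex_le u ((shift_map ^^ n) u)" and uK: "\<And>j. u j \<le> K"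
    and d0: "d 0 = N" and d: "\<And>j. 0 < j \<Longrightarrow> K + 2 \<le> d j \<and> d j + K + 1 \<le> N"
    and \<beta>: "real N < \<beta>" and root: "expansion \<beta> (\<lambda>j. real (d j)) = 1"
  shows "specification_property (ab_shift (alpha_of u \<beta>) \<beta>)"
proof -
  define \<alpha> where "\<alpha> = alpha_of u \<beta>"
  define S where "S = expansion \<beta> (\<lambda>j. real (u j))"
  define v where "v j = u j + d j" for j
  have KN: "2 * K + 3 \<le> N" using d[of 1] by simp
  have \<beta>1: "1 < \<beta>" and \<beta>K: "real K + 1 < \<beta>" using KN \<beta> by linarith+
  have v0: "v 0 = N" by (simp add: v_def u0 d0)
  have v: "K + 2 \<le> v j" "v (Suc j) + 1 \<le> N" "v j \<le> N" for j
    using d[of j] d[of "Suc j"] uK[of j] uK[of "Suc j"] v0 KN by (cases j; simp add: v_def)+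
  have ubd: "\<bar>real (u j)\<bar> \<le> real K" and vbd: "\<bar>real (v j)\<bar> \<le> real N" for j
    using uK[of j] v(3)[of j] by (auto simp: v_def)
  have \<alpha>_eq: "\<alpha> = \<beta> * S - S" by (simp add: \<alpha>_def alpha_of_def S_def expansion_def algebra_simps)
  have S0: "0 \<le> S" unfolding S_def using expansion_ge[OF \<beta>1 ubd, of 0] by simp
  have Keps: "real K / (\<beta> - 1) < 1" using \<beta>K by simp
  have uK': "expansion \<beta> (\<lambda>j. real (u (j + n))) \<le> real K / (\<beta> - 1)" for n
    using \<beta>1 uK ubd by (intro expansion_le[where B = K]) auto
  have "0 \<le> \<alpha>" using S0 \<beta>1 mult_right_mono[of 1 \<beta> S] by (simp add: \<alpha>_eq)
  moreover have "\<alpha> < 1"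
    using expansion_Suc[OF \<beta>1 ubd] uK'[of 1] Keps S0 by (simp add: \<alpha>_eq S_def u0)
  ultimately have ab: "0 \<le> \<alpha>" "\<alpha> < 1" "1 < \<beta>" using \<beta>1 by auto

  define a where "a n = expansion \<beta> (\<lambda>j. real (u (j + n))) - S" for n
  have a_step: "\<beta> * a n + \<alpha> = real (u n) + a (Suc n)" for n
    using expansion_Suc[OF \<beta>1, of "\<lambda>j. real (u (j + n))" K] ubd by (simp add: a_def \<alpha>_eq algebra_simps)
  have a_lt: "a n < 1" for n unfolding a_def using uK'[of n] Keps S0 by linarith
  \<comment> \<open>Lexicographic minimality of \<open>u\<close> enters here: at the first
    disagreement the shifted sequence is larger, and \<open>K < \<beta> - 1\<close> makes its
    expansion larger.\<close>
  have a_ge: "0 \<le> a n" for n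
  proof (cases "u = (shift_map ^^ n) u")
    case True
    then have "u (j + n) = u j" for j by (metis shift_map_funpow)
    then show ?thesis by (simp add: a_def S_def)
  next
    case False
    then have "less_fun u ((shift_map ^^ n) u)" using u_lex[of n] by (auto simp: lex_le_def)
    then obtain k where k: "u k < u (k + n)" "\<And>j. j < k \<Longrightarrow> u j = u (j + n)"
      by (auto simp: less_fun_def shift_map_funpow)
    have "0 \<le> (1 - real K / (\<beta> - 1)) / \<beta> ^ (k + 1)" using Keps \<beta>1 by simp
    also have "\<dots> \<le> expansion \<beta> (\<lambda>j. real (u (j + n)) - real (u j))"
    proof (rule expansion_lex_ge[OF \<beta>1])
      show "\<bar>real (u (j + n)) - real (u j)\<bar> \<le> real K" for j using uK[of j] uK[of "j + n"] by linarith
      show "- real K \<le> real (u (j + n)) - real (u j)" for j using uK[of j] by linarith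
    qed (use k in auto)
    also have "\<dots> = a n"
      unfolding a_def S_def using \<beta>1 ubd uK by (intro expansion_diff[where B = K and B' = K]) auto
    finally show ?thesis .
  qed
  have a0: "a 0 = 0" by (simp add: a_def S_def)
  have T_a: "T_ab \<alpha> \<beta> (a n) = a (Suc n)" for n
    using T_ab_eq[of "int (u n)" \<beta> "a n" \<alpha>] a_ge[of "Suc n"] a_lt[of "Suc n"] by (simp add: a_step)

  define b where "b n = expansion \<beta> (\<lambda>j. real (v (j + n))) - S" for n
  have b_step: "\<beta> * b n + \<alpha> = real (v n) + b (Suc n)" for n
    using expansion_Suc[OF \<beta>1, of "\<lambda>j. real (v (j + n))" N] vbd by (simp add: b_def \<alpha>_eq algebra_simps)
  \<comment> \<open>Subtracting \<open>u\<close> from \<open>v\<close> leaves \<open>d\<close>, so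
    this is the root equation.\<close>
  have b0: "b 0 = 1"
  proof -
    have "b 0 = expansion \<beta> (\<lambda>j. real (v j) - real (u j))"
      unfolding b_def S_def using expansion_diff[OF \<beta>1 vbd ubd] by simp
    then show ?thesis using root by (simp add: v_def)
  qed
  \<comment> \<open>Digits at least \<open>K + 2\<close> beat \<open>S\<close>, whose digits are at
    most \<open>K\<close>; after index 0 they are at most \<open>N - 1\<close>, which keeps the
    value below 1.\<close>
  have b_Suc: "0 < b (Suc n) \<and> b (Suc n) < 1" for n
  proof -
    have "(real K + 2) / (\<beta> - 1) \<le> expansion \<beta> (\<lambda>j. real (v (j + Suc n)))"
      using vbd v(1) by (intro expansion_ge[OF \<beta>1, of _ N]) (force, metis of_nat_add of_nat_numeral of_nat_le_iff)
    moreover have "S \<le> real K / (\<beta> - 1)" using uK'[of 0] by (simp add: S_def)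
    moreover have "real K / (\<beta> - 1) < (real K + 2) / (\<beta> - 1)" using \<beta>1 by (intro divide_strict_right_mono) auto
    ultimately have "0 < b (Suc n)" unfolding b_def by linarith
    have "real (v (j + Suc n)) \<le> real N - 1" for j using v(2)[of "j + n"] by simp
    then have "expansion \<beta> (\<lambda>j. real (v (j + Suc n))) \<le> (real N - 1) / (\<beta> - 1)"
      using vbd by (intro expansion_le[OF \<beta>1, of _ N]) auto
    also have "\<dots> < 1" using \<beta> \<beta>1 by simp
    finally show ?thesis using S0 \<open>0 < b (Suc n)\<close> unfolding b_def by linarith
  qed
  have b_bounds: "0 < b n" "b n \<le> 1" for n
    using b0 b_Suc[of "n - 1"] by (cases n; simp)+

  have "specification_property (ab_shift \<alpha> \<beta>)"
  proof (rule specification_if_separating_symbol[OF ab, of "range a" "range b" "K + 1"])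
    show "0 \<in> range a" using a0 by (metis rangeI)
    show "1 \<in> range b" using b0 by (metis rangeI)
    show "T_ab \<alpha> \<beta> x \<in> range a" if "x \<in> range a" for x using that T_a by auto
    show "\<beta> * y + \<alpha> - of_int j \<in> range b"
      if "y \<in> range b" "of_int j < \<beta> * y + \<alpha>" "\<beta> * y + \<alpha> \<le> of_int j + 1" for y j
    proof -
      from that(1) obtain n where y: "y = b n" by blast
      \<comment> \<open>\<open>b (Suc n)\<close> lies in (0,1], exactly the half-open range that
        determines the digit.\<close>
      have "j = int (v n)" using that(2,3) b_bounds[of "Suc n"] unfolding y b_step by linarith
      then show ?thesis unfolding y b_step by simp
    qed
    show "\<beta> * x + \<alpha> \<le> real (K + 1)" if "x \<in> range a" for x
    proof -
      from that obtain n where x: "x = a n" by blast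
      show ?thesis unfolding x a_step using uK[of n] a_lt[of "Suc n"] by simp
    qed
    show "real (K + 1) + 1 \<le> \<beta> * y + \<alpha>" if "y \<in> range b" for y
    proof -
      from that obtain n where y: "y = b n" by blast
      show ?thesis unfolding y b_step using v(1)[of n] b_bounds(1)[of "Suc n"] by simp
    qed
  qed (use a_ge b_bounds in auto)
  then show ?thesis by (simp add: \<alpha>_def)
qed

section \<open>Parametrisation by base \<open>M\<close> digits\<close>

lemma first_differing_digit:
  fixes M :: nat and t t' :: real
  assumes M: "2 \<le> M" and t: "t \<in> {0..<1}" and t': "t' \<in> {0..<1}" and ne: "t \<noteq> t'"
  obtains n where "0 < n"
    "\<And>j. j < n \<Longrightarrow> \<lfloor>M ^ j * t\<rfloor> mod M = \<lfloor>M ^ j * t'\<rfloor> mod M"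
    "\<lfloor>M ^ n * t\<rfloor> mod M \<noteq> \<lfloor>M ^ n * t'\<rfloor> mod M"
    "\<bar>t - t'\<bar> \<le> real M / real M ^ n"
proof -
  \<comment> \<open>The first \<open>j\<close> base \<open>M\<close> digits of \<open>x\<close> read
    as one integer; division by \<open>M\<close> drops the last.\<close>
  define q where "q j x = \<lfloor>real M ^ j * x\<rfloor>" for j and x :: real
  have q_div: "q (Suc j) x div int M = q j x" for j x
  proof -
    have "q (Suc j) x div int M = \<lfloor>(real M ^ Suc j * x) / real_of_int (int M)\<rfloor>"
      unfolding q_def by (rule floor_divide_real_eq_div[symmetric]) simp
    also have "(real M ^ Suc j * x) / real_of_int (int M) = real M ^ j * x" using M by simp
    finally show ?thesis by (simp add: q_def)
  qed
  have ex: "\<exists>n. q n t \<noteq> q n t'"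
  proof -
    have "1 < real M" using M by simp
    then obtain n where n: "1 / \<bar>t - t'\<bar> < real M ^ n" using real_arch_pow by blast
    then have "1 < \<bar>real M ^ n * t - real M ^ n * t'\<bar>"
      using ne by (simp add: divide_less_eq abs_mult flip: right_diff_distrib)
    then show ?thesis unfolding q_def by (intro exI[of _ n]) linarith
  qed
  \<comment> \<open>The prefixes of length \<open>n - 1\<close> still agree, which bounds the
    distance and forces the last digits at \<open>n\<close> to differ.\<close>
  define n where "n = (LEAST n. q n t \<noteq> q n t')"
  have n: "q n t \<noteq> q n t'" unfolding n_def using ex by (rule LeastI_ex)
  have less: "q j t = q j t'" if "j < n" for j using not_less_Least[of j "\<lambda>n. q n t \<noteq> q n t'"] that by (auto simp: n_def)
  have "q 0 x = 0" if "x \<in> {0..<1}" for x using that by (simp add: q_def floor_eq_iff)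
  then have "q 0 t = q 0 t'" using t t' by metis
  then have "n \<noteq> 0" using n by metis
  then obtain m where m: "n = Suc m" by (cases n) auto
  show ?thesis
  proof
    show "0 < n" using m by simp
    show "\<lfloor>M ^ j * t\<rfloor> mod M = \<lfloor>M ^ j * t'\<rfloor> mod M" if "j < n" for j
      using less[OF that] by (simp add: q_def)
    have "q n t div int M = q n t' div int M" using q_div less[of m] m by simp
    then have "q n t mod int M \<noteq> q n t' mod int M" using n by (metis div_mult_mod_eq)
    then show "\<lfloor>M ^ n * t\<rfloor> mod M \<noteq> \<lfloor>M ^ n * t'\<rfloor> mod M" by (simp add: q_def)
    have "q m t = q m t'" using less m by simp
    then have "\<bar>real M ^ m * t - real M ^ m * t'\<bar> \<le> 1" unfolding q_def by linarith
    then have "real M ^ m * \<bar>t - t'\<bar> \<le> 1" by (simp add: abs_mult flip: right_diff_distrib)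
    then have "\<bar>t - t'\<bar> \<le> 1 / real M ^ m" using M by (simp add: le_divide_eq mult.commute)
    also have "\<dots> = real M / real M ^ n" using M by (simp add: m)
    finally show "\<bar>t - t'\<bar> \<le> real M / real M ^ n" .
  qed
qed

text \<open>If digits first differ at \<open>n\<close>, parameters are within \<open>M / M^n\<close>
  and roots at least \<open>c / (N + 1)^n\<close> apart. The inverse Hoelder bound follows from
  \<open>(N + 1) powr s \<le> M\<close>, which holds for large \<open>N\<close> because
  \<open>s < 1\<close>.\<close>

lemma hausdorff_measure_specification_nonzero:
  fixes u :: "nat \<Rightarrow> nat" and K :: nat
  assumes u0: "u 0 = 0" and u_lex: "\<And>n. lex_le u ((shift_map ^^ n) u)" and uK: "\<And>j. u j \<le> K"
    and s: "0 \<le> s" "s < 1"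
  shows "hausdorff_measure s {\<beta>::real. \<beta> > real K + 2 \<and> specification_property (ab_shift (alpha_of u \<beta>) \<beta>)} \<noteq> 0"
proof -
  have "\<forall>\<^sub>F N in sequentially. (real N + 1) powr s \<le> real N - 2 * real K - 2"
    using s by real_asymp
  then obtain N0 where N0: "\<And>N. N \<ge> N0 \<Longrightarrow> (real N + 1) powr s \<le> real N - 2 * real K - 2"
    by (auto simp: eventually_sequentially)
  define N where "N = max N0 (2 * K + 4)"
  define M where "M = N - 2 * K - 2"
  have N: "2 * K + 4 \<le> N" by (simp add: N_def)
  have M: "2 \<le> M" "N = M + 2 * K + 2" using N by (auto simp: M_def)
  have NM: "(real N + 1) powr s \<le> real M" using N0[of N] M(2) by (auto simp: N_def)
  \<comment> \<open>Index 0 is reserved for the leading digit \<open>N\<close>. The offset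
    \<open>K + 2\<close> places the \<open>M\<close> residues exactly in the range from
    \<open>K + 2\<close> to \<open>N - K - 1\<close>.\<close>
  define d where "d t j = (if j = 0 then N else K + 2 + nat (\<lfloor>real M ^ j * t\<rfloor> mod int M))" for t :: real and j :: nat
  have dig: "0 \<le> i mod int M" "i mod int M < int M" for i using M(1) by auto
  have d: "K + 2 \<le> d t j \<and> d t j + K + 1 \<le> N" if "0 < j" for t j
    using that dig[of "\<lfloor>real M ^ j * t\<rfloor>"] M(2) by (simp add: d_def)
  have dN: "\<bar>real (d t j)\<bar> \<le> real N" for t j
    using d[of j t] by (cases "j = 0") (auto simp: d_def)
  have "\<exists>\<beta>\<in>{real N<..<real N + 1}. expansion \<beta> (\<lambda>j. real (d t j)) = 1" for t
  proof (rule exists_expansion_eq_1)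
    show "1 \<le> real (d t j) \<and> real (d t j) \<le> real N - 1" if "0 < j" for j
      using d[OF that, of t] by linarith
  qed (use N in \<open>auto simp: d_def\<close>)
  then obtain g where g: "\<And>t. g t \<in> {real N<..<real N + 1}" "\<And>t. expansion (g t) (\<lambda>j. real (d t j)) = 1"
    by metis
  define c where "c = 1 / (4 * real N ^ 2 * (real N + 1))"
  have c: "0 < c" using N by (simp add: c_def)
  \<comment> \<open>Chosen so that \<open>C * (c powr s / M^n)\<close> is the bound
    \<open>M / M^n\<close> on the parameter distance.\<close>
  define C where "C = real M / c powr s"
  show ?thesis
  proof (rule hausdorff_measure_nonzero_if_inverse_hoelder[of g _ C])
    show "g ` {0..<1} \<subseteq> {\<beta>. real K + 2 < \<beta> \<and> specification_property (ab_shift (alpha_of u \<beta>) \<beta>)}"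
    proof (intro image_subsetI CollectI conjI)
      fix t :: real
      show "real K + 2 < g t" using g(1)[of t] N by simp
      show "specification_property (ab_shift (alpha_of u (g t)) (g t))"
        using g[of t] d by (intro specification_if_restricted_digits[OF u0 u_lex uK, of "d t" N]) (auto simp: d_def)
    qed
    show "0 < C" using c M by (simp add: C_def)
    show "\<bar>t - t'\<bar> \<le> C * dist (g t) (g t') powr s" if t: "t \<in> {0..<1}" and t': "t' \<in> {0..<1}" for t t'
    proof (cases "t = t'")
      case True
      then show ?thesis using \<open>0 < C\<close> by simp
    next
      case False
      from first_differing_digit[OF M(1) t t' False] obtain n where n: "0 < n"
        "\<And>j. j < n \<Longrightarrow> \<lfloor>real M ^ j * t\<rfloor> mod int M = \<lfloor>real M ^ j * t'\<rfloor> mod int M"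
        "\<lfloor>real M ^ n * t\<rfloor> mod int M \<noteq> \<lfloor>real M ^ n * t'\<rfloor> mod int M"
        "\<bar>t - t'\<bar> \<le> real M / real M ^ n" by auto
      have "c / (real N + 1) ^ n \<le> \<bar>g t - g t'\<bar>"
        unfolding c_def
      proof (rule expansion_roots_separated[OF _ g(1) g(2) g(1) g(2)])
        show "2 \<le> real N" using N by simp
        \<comment> \<open>Two residues differ by at most \<open>M - 1\<close>, that is
          \<open>N - 2 * K - 3\<close>.\<close>
        show "\<bar>real (d t j) - real (d t' j)\<bar> \<le> real N - 3" for j
          using d[of j t] d[of j t'] N by (cases "j = 0") (auto simp: d_def)
        show "real (d t j) = real (d t' j)" if "j < n" for j
          using n(2)[OF that] by (simp add: d_def)
        have "d t n \<noteq> d t' n" using n(1,3) dig by (simp add: d_def eq_nat_nat_iff)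
        then show "1 \<le> \<bar>real (d t n) - real (d t' n)\<bar>" by linarith
      qed (rule dN)+
      then have "(c / (real N + 1) ^ n) powr s \<le> dist (g t) (g t') powr s"
        using s c by (intro powr_mono2) (auto simp: dist_real_def)
      moreover have "c powr s / real M ^ n \<le> (c / (real N + 1) ^ n) powr s"
      proof -
        have "((real N + 1) ^ n) powr s = ((real N + 1) powr s) ^ n"
          by (simp add: powr_powr powr_power mult.commute flip: powr_realpow)
        also have "\<dots> \<le> real M ^ n" using NM by (intro power_mono) auto
        finally show ?thesis using c M(1) N by (subst powr_divide) (auto intro!: divide_left_mono mult_pos_pos)
      qed
      ultimately have "c powr s / real M ^ n \<le> dist (g t) (g t') powr s" by linarith
      then have "C * (c powr s / real M ^ n) \<le> C * dist (g t) (g t') powr s"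
        using \<open>0 < C\<close> by (intro mult_left_mono) auto
      moreover have "C * (c powr s / real M ^ n) = real M / real M ^ n" using c by (simp add: C_def)
      ultimately show ?thesis using n(4) by linarith
    qed
  qed (rule s)
qed

theorem theorem1:
  fixes u :: "nat \<Rightarrow> nat" and K :: nat
  assumes "u 0 = 0"
    and "\<And>n. lex_le u ((shift_map ^^ n) u)"
    and "finite (range u)"
    and "K = Max (range u)"
  shows "hausdorff_dim {\<beta>::real. \<beta> > real K + 2 \<and>
           specification_property (ab_shift (alpha_of u \<beta>) \<beta>)} = 1"
proof -
  define E where "E = {\<beta>::real. \<beta> > real K + 2 \<and> specification_property (ab_shift (alpha_of u \<beta>) \<beta>)}"
  have uK: "u j \<le> K" for j using assms(3,4) by auto
  have "1 \<le> ennreal s" if "0 \<le> s" "hausdorff_measure s E = 0" for s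
  proof -
    have "\<not> s < 1" using hausdorff_measure_specification_nonzero[OF assms(1,2) uK, of s] that unfolding E_def by blast
    then show ?thesis by simp
  qed
  then have "1 \<le> hausdorff_dim E" unfolding hausdorff_dim_def by (intro INF_greatest) auto
  \<comment> \<open>The measure vanishes for each exponent \<open>1 + e\<close> with
    \<open>e > 0\<close>, and \<open>e\<close> is arbitrary.\<close>
  moreover have "hausdorff_dim E \<le> 1"
  proof (rule ennreal_le_epsilon)
    fix e :: real assume "0 < e"
    have "hausdorff_measure (1 + e) E = 0"
      using \<open>0 < e\<close> by (intro hausdorff_measure_halfline_eq_0) (auto simp: E_def)
    then have "hausdorff_dim E \<le> ennreal (1 + e)"
      unfolding hausdorff_dim_def using \<open>0 < e\<close> by (intro INF_lower) auto
    then show "hausdorff_dim E \<le> 1 + ennreal e" using \<open>0 < e\<close> by (simp add: ennreal_plus)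
  qed
  ultimately show ?thesis unfolding E_def by simp
qed

end
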